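(* For every graph $\Gamma=(V,E)$, the neighbourhood closure operator $2^V\to 2^V$, $X\mapsto\hat{X}$, is a Moore closure operator on $V$. It is not, in general, a Kuratowski closure operator: there exists a graph $\Gamma$ whose neighbourhood closure operator is not a Kuratowski closure operator on its vertex set.
   Context: A graph $\Gamma=(V,E)$ has nonempty vertex set $V$ and edge set $E\subseteq\{e\subseteq V:|e|=2\}$. For $x\in V$, the closed neighbourhood is $N[x]=\{y\in V:\{x,y\}\in E\}\cup\{x\}$. For $X\subseteq V$, the common closed neighbourhood is $N[X]=\bigcap_{x\in X}N[x]$ if $X\neq\varnothing$, and $N[\varnothing]=V$. The neighbourhood closure of $X$ is $\hat{X}=N[N[X]]$. A function $c:2^V\to 2^V$ is a Moore closure operator if it is isotone ($A\subseteq B$ implies $c(A)\subseteq c(B)$), extensive ($A\subseteq c(A)$) and idempotent ($c(c(A))=c(A)$). It is a Kuratowski closure operator if $c(\varnothing)=\varnothing$, $c$ is extensive and idempotent, and $c(A\cup B)=c(A)\cup c(B)$ for all $A,B\subseteq V$. *)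

theory Defs
  imports Main "HOL-Library.FuncSet"
begin

definition graph :: "'a set \<Rightarrow> 'a set set \<Rightarrow> bool" where
  "graph V E \<longleftrightarrow> V \<noteq> {} \<and> E \<subseteq> {e. e \<subseteq> V \<and> card e = 2}"

definition closed_nbhd :: "'a set \<Rightarrow> 'a set set \<Rightarrow> 'a \<Rightarrow> 'a set" where
  "closed_nbhd V E x = {y \<in> V. {x, y} \<in> E} \<union> {x}"

definition common_closed_nbhd :: "'a set \<Rightarrow> 'a set set \<Rightarrow> 'a set \<Rightarrow> 'a set" where
  "common_closed_nbhd V E X = (if X = {} then V else (\<Inter>x\<in>X. closed_nbhd V E x))"

definition nbhd_closure :: "'a set \<Rightarrow> 'a set set \<Rightarrow> 'a set \<Rightarrow> 'a set" where
  "nbhd_closure V E X = common_closed_nbhd V E (common_closed_nbhd V E X)"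

(* Closure operators on V are HOL functions constrained only on subsets of V;
   their values on other sets are irrelevant. *)

definition moore_closure_operator :: "'a set \<Rightarrow> ('a set \<Rightarrow> 'a set) \<Rightarrow> bool" where
  "moore_closure_operator V c \<longleftrightarrow>
     c \<in> Pow V \<rightarrow> Pow V \<and>
     (\<forall>A B. A \<subseteq> B \<and> B \<subseteq> V \<longrightarrow> c A \<subseteq> c B) \<and>
     (\<forall>A. A \<subseteq> V \<longrightarrow> A \<subseteq> c A) \<and>
     (\<forall>A. A \<subseteq> V \<longrightarrow> c (c A) = c A)"

definition kuratowski_closure_operator :: "'a set \<Rightarrow> ('a set \<Rightarrow> 'a set) \<Rightarrow> bool" where
  "kuratowski_closure_operator V c \<longleftrightarrow>
     c \<in> Pow V \<rightarrow> Pow V \<and>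
     c {} = {} \<and>
     (\<forall>A. A \<subseteq> V \<longrightarrow> A \<subseteq> c A) \<and>
     (\<forall>A. A \<subseteq> V \<longrightarrow> c (c A) = c A) \<and>
     (\<forall>A B. A \<subseteq> V \<and> B \<subseteq> V \<longrightarrow> c (A \<union> B) = c A \<union> c B)"

end

theory Submission
  imports Defs
begin

text \<open>
  Being equal or adjacent is a symmetric relation on \<^term>\<open>V\<close>, so for subsets of
  \<^term>\<open>V\<close> the inclusions \<open>Y \<subseteq> N[X]\<close> and \<open>X \<subseteq> N[Y]\<close> both say that every vertex of
  \<^term>\<open>X\<close> is equal or adjacent to every vertex of \<^term>\<open>Y\<close>. Thus
  \<open>N\<close> forms an antitone Galois connection with itself
  (\<open>subset_common_closed_nbhd_commute\<close>), and the composite of the two maps of a Galois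
  connection is always a Moore closure. Concretely, the connection makes \<open>N \<circ> N\<close>
  extensive and \<open>N\<close> antitone, so \<open>N \<circ> N\<close> is isotone; together these give
  \<open>N \<circ> N \<circ> N = N\<close> (\<open>common_closed_nbhd_nbhd_closure\<close>), hence idempotence.

  The Kuratowski axioms already fail at the empty set: its closure is \<open>N[V]\<close>, the set of
  vertices equal or adjacent to all vertices. This set is nonempty for the graph with one vertex.
\<close>

lemma mem_common_closed_nbhd_iff:
  assumes "X \<subseteq> V"
  shows "y \<in> common_closed_nbhd V E X \<longleftrightarrow> y \<in> V \<and> (\<forall>x\<in>X. y = x \<or> {x, y} \<in> E)"
proof (cases "X = {}")
  case True
  then show ?thesis by (simp add: common_closed_nbhd_def)
next
  case False
  then have "y \<in> common_closed_nbhd V E X \<longleftrightarrow> (\<forall>x\<in>X. y \<in> closed_nbhd V E x)"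
    by (simp add: common_closed_nbhd_def)
  moreover have "y \<in> closed_nbhd V E x \<longleftrightarrow> y \<in> V \<and> (y = x \<or> {x, y} \<in> E)" if "x \<in> X" for x
    using assms that by (auto simp: closed_nbhd_def)
  ultimately show ?thesis
    using False by blast
qed

lemma common_closed_nbhd_subset:
  assumes "X \<subseteq> V"
  shows "common_closed_nbhd V E X \<subseteq> V"
  using assms by (auto simp: mem_common_closed_nbhd_iff)

text \<open>
  The Galois connection. The two sides can be exchanged because edges are unordered pairs, so that
  adjacency is symmetric.
\<close>

lemma subset_common_closed_nbhd_commute:
  assumes "X \<subseteq> V" "Y \<subseteq> V"
  shows "Y \<subseteq> common_closed_nbhd V E X \<longleftrightarrow> X \<subseteq> common_closed_nbhd V E Y"
proof -
  have *: "B \<subseteq> common_closed_nbhd V E A \<longleftrightarrow> (\<forall>a\<in>A. \<forall>b\<in>B. b = a \<or> {a, b} \<in> E)"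
    if "A \<subseteq> V" "B \<subseteq> V" for A B
    unfolding subset_eq[of B] mem_common_closed_nbhd_iff[OF that(1)] using that(2) by blast
  have "b = a \<or> {a, b} \<in> E \<longleftrightarrow> a = b \<or> {b, a} \<in> E" for a b
    by (metis insert_commute)
  then show ?thesis
    unfolding *[OF assms] *[OF assms(2,1)] by blast
qed

lemma nbhd_closure_extensive:
  assumes "X \<subseteq> V"
  shows "X \<subseteq> nbhd_closure V E X"
  using subset_common_closed_nbhd_commute[OF assms common_closed_nbhd_subset[OF assms], of E E]
  by (simp add: nbhd_closure_def)

lemma common_closed_nbhd_antimono:
  assumes "X \<subseteq> Y" "Y \<subseteq> V"
  shows "common_closed_nbhd V E Y \<subseteq> common_closed_nbhd V E X"
proof -
  have "X \<subseteq> V" using assms by (rule subset_trans)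
  have "X \<subseteq> common_closed_nbhd V E (common_closed_nbhd V E Y)"
    using assms(1) nbhd_closure_extensive[OF assms(2)] unfolding nbhd_closure_def
    by (rule subset_trans)
  then show ?thesis
    by (rule subset_common_closed_nbhd_commute
        [OF \<open>X \<subseteq> V\<close> common_closed_nbhd_subset[OF assms(2)], THEN iffD2])
qed

text \<open>
  Of the two inclusions, one is extensivity at \<open>N[X]\<close> and the other is extensivity at
  \<^term>\<open>X\<close>, reversed by \<open>N\<close>.
\<close>

lemma common_closed_nbhd_nbhd_closure:
  assumes "X \<subseteq> V"
  shows "common_closed_nbhd V E (nbhd_closure V E X) = common_closed_nbhd V E X"
proof (rule subset_antisym)
  have "nbhd_closure V E X \<subseteq> V"
    unfolding nbhd_closure_def using assms by (intro common_closed_nbhd_subset)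
  then show "common_closed_nbhd V E (nbhd_closure V E X) \<subseteq> common_closed_nbhd V E X"
    using nbhd_closure_extensive[OF assms] by (intro common_closed_nbhd_antimono)
  show "common_closed_nbhd V E X \<subseteq> common_closed_nbhd V E (nbhd_closure V E X)"
    using nbhd_closure_extensive[OF common_closed_nbhd_subset[OF assms]]
    by (simp add: nbhd_closure_def)
qed

lemma moore_closure_operator_nbhd_closure:
  "moore_closure_operator V (nbhd_closure V E)"
  unfolding moore_closure_operator_def
proof (intro conjI allI impI)
  show "nbhd_closure V E \<in> Pow V \<rightarrow> Pow V"
    unfolding nbhd_closure_def by (intro Pi_I PowI common_closed_nbhd_subset) (rule PowD)
next
  fix A B assume "A \<subseteq> B \<and> B \<subseteq> V"
  then show "nbhd_closure V E A \<subseteq> nbhd_closure V E B"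
    unfolding nbhd_closure_def
    by (intro common_closed_nbhd_antimono common_closed_nbhd_subset) auto
next
  fix A assume "A \<subseteq> V"
  then show "A \<subseteq> nbhd_closure V E A"
    by (rule nbhd_closure_extensive)
next
  fix A assume "A \<subseteq> V"
  then show "nbhd_closure V E (nbhd_closure V E A) = nbhd_closure V E A"
    unfolding nbhd_closure_def[of V E "nbhd_closure V E A"]
    by (simp only: common_closed_nbhd_nbhd_closure) (simp only: nbhd_closure_def)
qed

lemma not_kuratowski_closure_operator_single_vertex:
  "\<not> kuratowski_closure_operator {v} (nbhd_closure {v} {})"
proof -
  have "nbhd_closure {v} {} {} = {v}"
    by (simp add: nbhd_closure_def common_closed_nbhd_def closed_nbhd_def)
  then show ?thesis
    by (simp add: kuratowski_closure_operator_def)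
qed

theorem corollary4:
  shows "(\<forall>(V :: 'a set) E. graph V E \<longrightarrow> moore_closure_operator V (nbhd_closure V E))
    \<and> (\<exists>(V :: nat set) E. graph V E \<and> \<not> kuratowski_closure_operator V (nbhd_closure V E))"
proof (intro conjI allI impI)
  fix V :: "'a set" and E
  show "moore_closure_operator V (nbhd_closure V E)"
    by (rule moore_closure_operator_nbhd_closure)
next
  have "graph {0 :: nat} {} \<and> \<not> kuratowski_closure_operator {0 :: nat} (nbhd_closure {0} {})"
    using not_kuratowski_closure_operator_single_vertex by (simp add: graph_def)
  then show "\<exists>(V :: nat set) E. graph V E \<and> \<not> kuratowski_closure_operator V (nbhd_closure V E)"
    by (intro exI)
qed

end
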